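(* Let $M$ be an irreducible and $\mathbb{P}^2$-irreducible 3-manifold with a triangulation $\Gamma$, where either $M$ is the interior of a compact manifold $N$ whose boundary components are tori and Klein bottles and $\Gamma$ is an ideal triangulation of $M$, or $M$ is closed and $\Gamma$ is a (non-ideal) triangulation of $M$. Suppose $\Gamma$ has $k$ tetrahedra $\Delta_1,\dots,\Delta_k$ and $e$ edges $E_1,\dots,E_e$, and let $\mathcal{V}\subset\mathbb{R}^{7k}$ be the real solution space of the compatibility equations of normal surface theory for $\Gamma$. Then $\mathcal{V}$ has a basis consisting of $k$ formal tetrahedral surfaces $\alpha_1,\dots,\alpha_k$ (one for each tetrahedron) and $e$ formal edge surfaces $\beta_1,\dots,\beta_e$ (one for each edge).
   Context: Triangulations. A triangulation $\Gamma$ of $M$ is a decomposition into tetrahedra whose faces are glued in pairs; several vertices, edges or faces of one tetrahedron may be identified with each other (a pseudo-triangulation). It is ideal if all vertices are removed and $M$ is the resulting space; the link of each removed vertex is then a torus or a Klein bottle. $\mathbb{P}^2$-irreducible means there are no embedded 2-sided projective planes; irreducible means every embedded 2-sphere bounds a 3-ball. Normal disk types. In a tetrahedron with vertices $A,B,C,D$ there are 4 normal triangle types, one cutting off each vertex, and 3 normal quadrilateral types, one separating each pair of opposite edges ($AB|CD$, $AC|BD$, $AD|BC$). The triangle cutting off $A$ has its corners on $AB,AC,AD$; the quadrilateral separating $AB$ from $CD$ has its corners on the other four edges $AC,AD,BC,BD$. Thus $k$ tetrahedra give $7k$ normal disk types and a coordinate space $\mathbb{R}^{7k}$. Compatibility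 equations. A normal arc type in a face $ABC$ of a tetrahedron is an arc joining two edges of the face, e.g. $AB$ and $AC$, cutting off their common vertex $A$. In the tetrahedron $ABCD$ exactly two normal disk types have this arc in their boundary: the triangle cutting off $A$ and the quadrilateral separating $AD$ from $BC$. If the face $ABC$ is glued to the face $A'B'C'$ of a tetrahedron $A'B'C'D'$ (possibly the same tetrahedron), with $A,B,C$ glued to $A',B',C'$, the compatibility equation for this arc type is $n_i+n_j=n_m+n_p$, where $n_i,n_j$ are the coordinates of the two disk types in $ABCD$ containing the arc type and $n_m,n_p$ are those of the two disk types in $A'B'C'D'$ containing the corresponding arc type in $A'B'C'$. There is one equation for each normal arc type in each glued face. $\mathcal{V}$ is the set of all real solutions; its elements (in particular integer solutions, with negative coordinates allowed) are regarded as formal normal surfaces. Tetrahedral surface $\alpha_i$: the vector in $\mathbb{R}^{7k}$ with coordinate $-1$ on each of the 4 triangle types of $\Delta_i$, coordinate $+1$ on each of the 3 quadrilateral types of $\Delta_i$, and all other coordinates $0$. Edge surface $\beta_i$: the vector in $\mathbb{R}^{7k}$ whose coordinate on a triangle type is $-n$, where $n\in\{0,1,2,3\}$ is the number of corners of that triangle lying on edges identified to $E_i$, and whose coordinate on the quadrilateral type separating opposite edges $AB$ and $CD$ of a tetrahedron is the number (0, 1 or 2) of the edges $AB$, $CD$ that are identified to $E_i$. *)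

theory Defs
  imports "HOL-Analysis.Analysis"
begin

section \<open>Quotient spaces and the model surfaces\<close>

text \<open>The points of the quotient are the classes \<open>r `` {x}\<close>; it is meant for \<open>r\<close> that
  restrict to an equivalence relation on \<open>topspace X\<close>.\<close>

definition quotient_topology :: "'a topology \<Rightarrow> ('a \<times> 'a) set \<Rightarrow> 'a set topology" where
  "quotient_topology X r =
     topology (\<lambda>U. U \<subseteq> topspace X // r \<and> openin X {x \<in> topspace X. r `` {x} \<in> U})"

lemma openin_quotient_topology:
  "openin (quotient_topology X r) U \<longleftrightarrow>
     U \<subseteq> topspace X // r \<and> openin X {x \<in> topspace X. r `` {x} \<in> U}"
proof -
  have 1: "openin X {x \<in> topspace X. r `` {x} \<in> S \<inter> T}"
    if "openin X {x \<in> topspace X. r `` {x} \<in> S}" "openin X {x \<in> topspace X. r `` {x} \<in> T}" for S T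
  proof -
    have "{x \<in> topspace X. r `` {x} \<in> S \<inter> T} =
      {x \<in> topspace X. r `` {x} \<in> S} \<inter> {x \<in> topspace X. r `` {x} \<in> T}" by auto
    with that show ?thesis by (simp only: openin_Int)
  qed
  have 2: "openin X {x \<in> topspace X. r `` {x} \<in> \<Union>K}"
    if "\<forall>S\<in>K. openin X {x \<in> topspace X. r `` {x} \<in> S}" for K
  proof -
    have "{x \<in> topspace X. r `` {x} \<in> \<Union>K} = (\<Union>S\<in>K. {x \<in> topspace X. r `` {x} \<in> S})" by auto
    with that show ?thesis by auto
  qed
  have "istopology (\<lambda>U. U \<subseteq> topspace X // r \<and> openin X {x \<in> topspace X. r `` {x} \<in> U})"
    unfolding istopology_def using 1 2 by (simp add: Sup_le_iff) blast
  then show ?thesis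
    unfolding quotient_topology_def by (simp add: topology_inverse')
qed

lemma topspace_quotient_topology: "topspace (quotient_topology X r) = topspace X // r"
proof
  show "topspace (quotient_topology X r) \<subseteq> topspace X // r"
    unfolding topspace_def[of "quotient_topology X r"] openin_quotient_topology by auto
  have "{x \<in> topspace X. r `` {x} \<in> topspace X // r} = topspace X"
    by (auto simp: quotient_def)
  then have "openin (quotient_topology X r) (topspace X // r)"
    by (simp add: openin_quotient_topology)
  then show "topspace X // r \<subseteq> topspace (quotient_topology X r)"
    by (rule openin_subset)
qed

lemma quotient_map_quotient_topology:
  "quotient_map X (quotient_topology X r) (\<lambda>x. r `` {x})"
  unfolding quotient_map_def topspace_quotient_topology openin_quotient_topology
  by (auto simp: quotient_def)

abbreviation sphere_space :: "(real^3) topology" where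
  "sphere_space \<equiv> top_of_set (sphere 0 1)"

definition projective_plane :: "(real^3) set topology" where
  "projective_plane = quotient_topology sphere_space {(x, y). y = x \<or> y = - x}"

definition torus :: "(complex \<times> complex) topology" where
  "torus = prod_topology (top_of_set (sphere 0 1)) (top_of_set (sphere 0 1))"

text \<open>The Klein bottle is the quotient of the torus by the free, orientation-reversing
  involution \<open>(z, w) \<mapsto> (- z, cnj w)\<close>.\<close>

definition klein_bottle :: "(complex \<times> complex) set topology" where
  "klein_bottle = quotient_topology torus {(p, q). q = p \<or> q = (- fst p, cnj (snd p))}"


section \<open>Three-manifolds\<close>

definition manifold3_with_boundary :: "'a topology \<Rightarrow> bool" where
  "manifold3_with_boundary X \<longleftrightarrow>
     Hausdorff_space X \<and> second_countable X \<and>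
     (\<forall>x\<in>topspace X. \<exists>U V. openin X U \<and> x \<in> U \<and>
        openin (top_of_set {y :: real^3. 0 \<le> y $ 1}) V \<and>
        subtopology X U homeomorphic_space top_of_set V)"

definition manifold3_interior :: "'a topology \<Rightarrow> 'a set" where
  "manifold3_interior X =
     {x \<in> topspace X. \<exists>U V. openin X U \<and> x \<in> U \<and> open (V :: (real^3) set) \<and>
        subtopology X U homeomorphic_space top_of_set V}"

definition manifold3_boundary :: "'a topology \<Rightarrow> 'a set" where
  "manifold3_boundary X = topspace X - manifold3_interior X"

definition manifold3 :: "'a topology \<Rightarrow> bool" where
  "manifold3 X \<longleftrightarrow> manifold3_with_boundary X \<and> manifold3_boundary X = {}"

text \<open>Embedded surfaces in a 3-manifold are tame (no 3-manifold would be irreducible if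
  wild spheres were admitted). A 2-sided tame surface is the zero level of an embedding of
  \<open>surface \<times> [-1, 1]\<close>, and a tame 2-sphere in a 3-manifold is always 2-sided.\<close>

definition bicollared_embedding :: "'s topology \<Rightarrow> 'a topology \<Rightarrow> ('s \<times> real \<Rightarrow> 'a) \<Rightarrow> bool" where
  "bicollared_embedding S X f \<longleftrightarrow> embedding_map (prod_topology S (top_of_set {-1..1})) X f"

definition bounds_3ball :: "'a topology \<Rightarrow> 'a set \<Rightarrow> bool" where
  "bounds_3ball X S \<longleftrightarrow>
     (\<exists>h. embedding_map (top_of_set (cball (0 :: real^3) 1)) X h \<and> h ` sphere 0 1 = S)"

definition irreducible_manifold3 :: "'a topology \<Rightarrow> bool" where
  "irreducible_manifold3 X \<longleftrightarrow>
     (\<forall>f. bicollared_embedding sphere_space X f \<longrightarrow> bounds_3ball X (f ` (sphere 0 1 \<times> {0})))"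

definition P2_irreducible_manifold3 :: "'a topology \<Rightarrow> bool" where
  "P2_irreducible_manifold3 X \<longleftrightarrow> \<not> (\<exists>f. bicollared_embedding projective_plane X f)"


section \<open>Pseudo-triangulations\<close>

datatype vert = A | B | C | D

lemma UNIV_vert: "UNIV = {A, B, C, D}"
  using vert.exhaust by auto

instance vert :: finite
  by standard (simp add: UNIV_vert)

text \<open>\<open>G (t, d) = (t', \<sigma>)\<close> says that the face of tetrahedron \<open>t\<close> opposite to vertex \<open>d\<close> is glued
  to the face of \<open>t'\<close> opposite to \<open>\<sigma> d\<close>, each vertex \<open>v \<noteq> d\<close> of the former being glued
  to the vertex \<open>\<sigma> v\<close> of the latter.\<close>

type_synonym 't gluing = "'t \<times> vert \<Rightarrow> 't \<times> (vert \<Rightarrow> vert)"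

definition face_pairing :: "'t gluing \<Rightarrow> bool" where
  "face_pairing G \<longleftrightarrow>
     (\<forall>t d t' \<sigma>. G (t, d) = (t', \<sigma>) \<longrightarrow>
        bij \<sigma> \<and> (t', \<sigma> d) \<noteq> (t, d) \<and> G (t', \<sigma> d) = (t, inv \<sigma>))"

text \<open>A tetrahedron is the standard simplex, in barycentric coordinates.\<close>

definition std_tetrahedron :: "(real^vert) set" where
  "std_tetrahedron = {x. (\<forall>v. 0 \<le> x $ v) \<and> (\<Sum>v\<in>UNIV. x $ v) = 1}"

definition point_gluing :: "'t gluing \<Rightarrow> (('t \<times> (real^vert)) \<times> ('t \<times> (real^vert))) set" where
  "point_gluing G =
     {((t, x), (t', \<chi> v. x $ inv \<sigma> v)) | t x t' \<sigma>.
        x \<in> std_tetrahedron \<and> (\<exists>d. x $ d = 0 \<and> G (t, d) = (t', \<sigma>))}"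

abbreviation point_equiv :: "'t gluing \<Rightarrow> (('t \<times> (real^vert)) \<times> ('t \<times> (real^vert))) set" where
  "point_equiv G \<equiv> (point_gluing G \<union> (point_gluing G)\<inverse>)\<^sup>*"

definition realization :: "'t gluing \<Rightarrow> ('t \<times> (real^vert)) set topology" where
  "realization G =
     quotient_topology (sum_topology (\<lambda>t. top_of_set std_tetrahedron) UNIV) (point_equiv G)"

definition realization_vertices :: "'t gluing \<Rightarrow> ('t \<times> (real^vert)) set set" where
  "realization_vertices G = {point_equiv G `` {(t, axis v 1)} | t v. True}"

definition pseudo_triangulation :: "'t gluing \<Rightarrow> 'a topology \<Rightarrow> bool" where
  "pseudo_triangulation G M \<longleftrightarrow> face_pairing G \<and> realization G homeomorphic_space M"

definition ideal_pseudo_triangulation :: "'t gluing \<Rightarrow> 'a topology \<Rightarrow> bool" where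
  "ideal_pseudo_triangulation G M \<longleftrightarrow> face_pairing G \<and>
     subtopology (realization G) (topspace (realization G) - realization_vertices G)
       homeomorphic_space M"

text \<open>An edge of a tetrahedron is the set of its two endpoints; an edge of the triangulation is a
  class of edges of tetrahedra under the face gluings.\<close>

definition edge_gluing :: "'t gluing \<Rightarrow> (('t \<times> vert set) \<times> ('t \<times> vert set)) set" where
  "edge_gluing G =
     {((t, x), (t', \<sigma> ` x)) | t x t' \<sigma>. card x = 2 \<and> (\<exists>d. d \<notin> x \<and> G (t, d) = (t', \<sigma>))}"

definition edges :: "'t gluing \<Rightarrow> ('t \<times> vert set) set set" where
  "edges G = {(t, x). card x = 2} // (edge_gluing G \<union> (edge_gluing G)\<inverse>)\<^sup>*"


section \<open>Normal disk types and compatibility equations\<close>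

datatype quad = AB_CD | AC_BD | AD_BC

datatype disk = Tri vert | Quad quad

lemma UNIV_quad: "UNIV = {AB_CD, AC_BD, AD_BC}"
  using quad.exhaust by auto

lemma UNIV_disk: "UNIV = range Tri \<union> range Quad"
  by (metis UNIV_eq_I Un_iff disk.exhaust rangeI)

instance quad :: finite
  by standard (simp add: UNIV_quad)

instance disk :: finite
  by standard (simp add: UNIV_disk)

lemma card_disk: "CARD(disk) = 7"
proof -
  have *: "(UNIV :: disk set) = {Tri A, Tri B, Tri C, Tri D, Quad AB_CD, Quad AC_BD, Quad AD_BC}"
    by (auto simp: UNIV_disk UNIV_vert UNIV_quad)
  show ?thesis by (subst *) simp
qed

fun separated_edges :: "quad \<Rightarrow> vert set set" where
  "separated_edges AB_CD = {{A, B}, {C, D}}"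
| "separated_edges AC_BD = {{A, C}, {B, D}}"
| "separated_edges AD_BC = {{A, D}, {B, C}}"

fun corners :: "disk \<Rightarrow> vert set set" where
  "corners (Tri v) = {x. card x = 2 \<and> v \<in> x}"
| "corners (Quad q) = {x. card x = 2} - separated_edges q"

text \<open>The edges on which the normal arc cutting off \<open>a\<close> in the face opposite to \<open>d\<close> ends.\<close>

definition arc_ends :: "vert \<Rightarrow> vert \<Rightarrow> vert set set" where
  "arc_ends a d = {{a, v} | v. v \<noteq> a \<and> v \<noteq> d}"

text \<open>The two disk types having that arc in their boundary.\<close>

definition disks_at_arc :: "vert \<Rightarrow> vert \<Rightarrow> disk set" where
  "disks_at_arc a d = {\<delta>. arc_ends a d \<subseteq> corners \<delta>}"

lemma disks_at_arc:
  assumes "a \<noteq> d" "{a, d} \<in> separated_edges q"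
  shows "disks_at_arc a d = {Tri a, Quad q}"
proof -
  have all: "(\<forall>v. P v) \<longleftrightarrow> P A \<and> P B \<and> P C \<and> P D" for P :: "vert \<Rightarrow> bool"
    by (metis vert.exhaust)
  have sub: "arc_ends a d \<subseteq> corners \<delta> \<longleftrightarrow> (\<forall>v. v \<noteq> a \<and> v \<noteq> d \<longrightarrow> {a, v} \<in> corners \<delta>)" for \<delta>
    by (auto simp: arc_ends_def)
  have "arc_ends a d \<subseteq> corners (Tri v) \<longleftrightarrow> v = a" for v
    using assms(1) unfolding sub all by (cases a; cases d; cases v) auto
  moreover have "arc_ends a d \<subseteq> corners (Quad q') \<longleftrightarrow> q' = q" for q'
    using assms unfolding sub all
    by (cases a; cases d; cases q; cases q') (auto simp: doubleton_eq_iff)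
  ultimately have "arc_ends a d \<subseteq> corners \<delta> \<longleftrightarrow> \<delta> = Tri a \<or> \<delta> = Quad q" for \<delta>
    by (cases \<delta>) auto
  then show ?thesis by (auto simp: disks_at_arc_def)
qed

text \<open>The coordinate space \<open>\<real>\<^sup>7\<^sup>k\<close> is \<open>real ^ ('t \<times> disk)\<close>, where \<open>k = CARD('t)\<close>.\<close>

definition solution_space :: "'t::finite gluing \<Rightarrow> (real ^ ('t \<times> disk)) set" where
  "solution_space G =
     {n. \<forall>t d a t' \<sigma>. a \<noteq> d \<and> G (t, d) = (t', \<sigma>) \<longrightarrow>
        (\<Sum>\<delta>\<in>disks_at_arc a d. n $ (t, \<delta>)) = (\<Sum>\<delta>\<in>disks_at_arc (\<sigma> a) (\<sigma> d). n $ (t', \<delta>))}"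

definition tetrahedral_surface :: "'t::finite \<Rightarrow> real ^ ('t \<times> disk)" where
  "tetrahedral_surface i =
     (\<chi> p. if fst p = i then (case snd p of Tri _ \<Rightarrow> -1 | Quad _ \<Rightarrow> 1) else 0)"

definition edge_surface :: "('t::finite \<times> vert set) set \<Rightarrow> real ^ ('t \<times> disk)" where
  "edge_surface E =
     (\<chi> p. case snd p of
        Tri v \<Rightarrow> - real (card {x \<in> corners (Tri v). (fst p, x) \<in> E})
      | Quad q \<Rightarrow> real (card {x \<in> separated_edges q. (fst p, x) \<in> E}))"

end

theory Submission
  imports Defs
begin

text \<open>
  For a vector \<open>n\<close> of normal coordinates, let the weight of \<open>n\<close> on an edge of a tetrahedron
  be the number of points in which the formal surface meets it, that is, the sum of the
  coordinates of the disk types that have a corner on that edge. This is a linear map from 7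
  coordinates to 6 weights in each tetrahedron, and three observations about it give the basis.

  First, in a face the three arc coordinates and the three edge weights determine each other:
  the weight of \<open>ab\<close> is the number of arcs cutting off \<open>a\<close> plus the number of arcs cutting off
  \<open>b\<close>, and this system can be solved for the arcs. Hence \<open>n\<close> satisfies the compatibility
  equations iff edges that are glued have the same weight
  (\<open>solution_iff_edge_weight_invariant\<close>), so the solution space is the preimage, under the
  weight map, of the functions that are constant on the edges of the triangulation.

  Second, the weights of the edge surface of \<open>E\<close> are \<open>-2\<close> on the edges in the class \<open>E\<close> and \<open>0\<close>
  elsewhere (\<open>edge_weight_edge_surface\<close>). So the weight map takes the edge surfaces to a basis of
  the functions that are constant on edge classes.

  Third, the kernel of the weight map is spanned by the tetrahedral surfaces
  (\<open>edge_weight_zero_imp_tetrahedral\<close>), and they are independent since their supports are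
  disjoint. A basis of the kernel together with a lift of a basis of the image is a basis.
\<close>

section \<open>Arcs and edge weights\<close>

text \<open>The number of arcs of the formal surface that cut off \<open>a\<close> in the face opposite to \<open>d\<close>;
  the compatibility equations equate two such numbers.\<close>

definition arc_sum :: "real ^ ('t::finite \<times> disk) \<Rightarrow> 't \<Rightarrow> vert \<Rightarrow> vert \<Rightarrow> real" where
  "arc_sum n t a d = (\<Sum>\<delta>\<in>disks_at_arc a d. n $ (t, \<delta>))"

text \<open>The number of intersection points of the formal surface with the edge \<open>x\<close>.\<close>

definition edge_weight :: "real ^ ('t::finite \<times> disk) \<Rightarrow> 't \<Rightarrow> vert set \<Rightarrow> real" where
  "edge_weight n t x = (\<Sum>\<delta> | x \<in> corners \<delta>. n $ (t, \<delta>))"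

lemma UNIV_vert_eq:
  assumes "distinct [a, b, c, d :: vert]"
  shows "UNIV = {a, b, c, d}"
proof -
  have "card {a, b, c, d} = CARD(vert)"
    using assms by (simp add: UNIV_vert)
  then show ?thesis by (intro card_subset_eq[symmetric]) auto
qed

lemma ex_separating_quad:
  assumes "a \<noteq> d"
  obtains q where "{a, d} \<in> separated_edges q"
proof -
  have "{a, d} \<in> separated_edges AB_CD \<or> {a, d} \<in> separated_edges AC_BD \<or> {a, d} \<in> separated_edges AD_BC"
    using assms by (cases a; cases d) (auto simp: doubleton_eq_iff)
  then show ?thesis using that by blast
qed

lemma arc_sum_eq:
  assumes "a \<noteq> d" "{a, d} \<in> separated_edges q"
  shows "arc_sum n t a d = n $ (t, Tri a) + n $ (t, Quad q)"
  using assms by (simp add: arc_sum_def disks_at_arc)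

lemma separated_edges_disjoint:
  assumes "{u, v} \<in> separated_edges q" "{u, w} \<in> separated_edges q"
  shows "v = w"
  using assms by (cases q) (auto simp: doubleton_eq_iff)

lemma separated_edges_complement:
  assumes "x \<in> separated_edges q"
  shows "separated_edges q = {x, - x}"
proof -
  have "- {A, B} = {C, D}" "- {C, D} = {A, B}" "- {A, C} = {B, D}" "- {B, D} = {A, C}"
    "- {A, D} = {B, C}" "- {B, C} = {A, D}"
    using UNIV_vert by auto
  then show ?thesis using assms by (cases q) auto
qed

text \<open>A disk with a corner on \<open>ab\<close> meets each face containing \<open>ab\<close> in exactly one arc that ends
  on \<open>ab\<close>, and this arc cuts off either \<open>a\<close> or \<open>b\<close>. For the quadrilaterals: the one
  missing \<open>ab\<close> is \<open>r\<close>, and \<open>p\<close> and \<open>q\<close> are the other two.\<close>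

lemma disks_at_edge:
  assumes "distinct [a, b, d]"
  shows "{\<delta>. {a, b} \<in> corners \<delta>} = disks_at_arc a d \<union> disks_at_arc b d"
    and "disks_at_arc a d \<inter> disks_at_arc b d = {}"
proof -
  obtain p q r where p: "{a, d} \<in> separated_edges p" and q: "{b, d} \<in> separated_edges q"
    and r: "{a, b} \<in> separated_edges r"
    using assms ex_separating_quad by (metis distinct_length_2_or_more)
  have arcs: "disks_at_arc a d = {Tri a, Quad p}" "disks_at_arc b d = {Tri b, Quad q}"
    using assms p q by (auto simp: disks_at_arc)
  have pqr: "p \<noteq> q" "p \<noteq> r" "q \<noteq> r"
    using assms p q r separated_edges_disjoint[of a d p b] separated_edges_disjoint[of b d q a]
      separated_edges_disjoint[of d a p b]
    by (auto simp: insert_commute)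
  have tri: "{a, b} \<in> corners (Tri v) \<longleftrightarrow> v = a \<or> v = b" for v
    using assms by auto
  have quad: "{a, b} \<in> corners (Quad s) \<longleftrightarrow> s = p \<or> s = q" for s
  proof -
    have "{a, b} \<notin> separated_edges p" "{a, b} \<notin> separated_edges q"
      using assms p q separated_edges_disjoint[of a d p b] separated_edges_disjoint[of b d q a]
      by (auto simp: insert_commute)
    moreover have "s = p \<or> s = q \<or> s = r"
      using pqr by (cases p; cases q; cases r; cases s) simp_all
    ultimately show ?thesis using assms r pqr by auto
  qed
  have "{a, b} \<in> corners \<delta> \<longleftrightarrow> \<delta> \<in> disks_at_arc a d \<union> disks_at_arc b d" for \<delta>
    unfolding arcs using tri quad by (cases \<delta>) (auto simp del: corners.simps)
  then show "{\<delta>. {a, b} \<in> corners \<delta>} = disks_at_arc a d \<union> disks_at_arc b d" by blast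
  show "disks_at_arc a d \<inter> disks_at_arc b d = {}"
    using assms pqr unfolding arcs by auto
qed

lemma edge_weight_eq_arc_sums:
  assumes "distinct [a, b, d]"
  shows "edge_weight n t {a, b} = arc_sum n t a d + arc_sum n t b d"
  unfolding edge_weight_def arc_sum_def disks_at_edge(1)[OF assms]
  by (rule sum.union_disjoint) (use disks_at_edge(2)[OF assms] in auto)

text \<open>Every arc in the face \<open>abc\<close> that ends on \<open>ab\<close> or \<open>ac\<close>
  without cutting off \<open>a\<close> also ends on \<open>bc\<close>, and these are all the arcs that end there.
  Arcs cutting off \<open>a\<close> are counted on both \<open>ab\<close> and \<open>ac\<close>.\<close>

lemma arc_sum_eq_edge_weights:
  assumes "distinct [a, b, c, d]"
  shows "2 * arc_sum n t a d = edge_weight n t {a, b} + edge_weight n t {a, c} - edge_weight n t {b, c}"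
  using assms by (simp add: edge_weight_eq_arc_sums[of _ _ d])

lemma ex_other_vertices:
  assumes "a \<noteq> (d::vert)"
  obtains b c where "distinct [a, b, c, d]"
proof -
  have "\<exists>b c. distinct [a, b, c, d]"
    using assms by (cases a; cases d) (simp_all, (metis vert.distinct)+)
  then show ?thesis using that by blast
qed

text \<open>A gluing of two faces identifies their edges as well as their arcs, and in each face arc
  numbers and edge weights are linear functions of one another.\<close>

lemma solution_iff_edge_weight_invariant:
  assumes "face_pairing G"
  shows "n \<in> solution_space G \<longleftrightarrow>
    (\<forall>t x t' x'. ((t, x), (t', x')) \<in> edge_gluing G \<longrightarrow> edge_weight n t x = edge_weight n t' x')"
    (is "_ \<longleftrightarrow> ?inv")
proof -
  have inj: "inj \<sigma>" if "G (t, d) = (t', \<sigma>)" for t d t' \<sigma>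
    using assms that unfolding face_pairing_def by (blast dest: bij_is_inj)
  have sol: "n \<in> solution_space G \<longleftrightarrow>
    (\<forall>t d a t' \<sigma>. a \<noteq> d \<and> G (t, d) = (t', \<sigma>) \<longrightarrow> arc_sum n t a d = arc_sum n t' (\<sigma> a) (\<sigma> d))"
    by (simp add: solution_space_def arc_sum_def)
  show ?thesis
  proof
    assume n: "n \<in> solution_space G"
    show ?inv
    proof (intro allI impI)
      fix t x t' x' assume "((t, x), (t', x')) \<in> edge_gluing G"
      then obtain d \<sigma> where *: "card x = 2" "d \<notin> x" "G (t, d) = (t', \<sigma>)" "x' = \<sigma> ` x"
        unfolding edge_gluing_def by auto
      obtain a b where x: "x = {a, b}" "a \<noteq> b"
        using *(1) by (auto simp: card_2_iff)
      have "distinct [a, b, d]" "distinct [\<sigma> a, \<sigma> b, \<sigma> d]"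
        using x *(2) inj[OF *(3)] by (auto dest: injD)
      moreover have "arc_sum n t a d = arc_sum n t' (\<sigma> a) (\<sigma> d)"
        "arc_sum n t b d = arc_sum n t' (\<sigma> b) (\<sigma> d)"
        using n *(2,3) x unfolding sol by auto
      ultimately show "edge_weight n t x = edge_weight n t' x'"
        by (simp add: x *(4) edge_weight_eq_arc_sums[of _ _ d] edge_weight_eq_arc_sums[of _ _ "\<sigma> d"])
    qed
  next
    assume inv: ?inv
    have "arc_sum n t a d = arc_sum n t' (\<sigma> a) (\<sigma> d)"
      if ad: "a \<noteq> d" and G: "G (t, d) = (t', \<sigma>)" for t d a t' \<sigma>
    proof -
      obtain b c where abcd: "distinct [a, b, c, d]"
        using ex_other_vertices[OF ad] .
      then have abcd': "distinct [\<sigma> a, \<sigma> b, \<sigma> c, \<sigma> d]"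
        using inj[OF G] by (auto dest: injD)
      have "edge_weight n t {u, v} = edge_weight n t' {\<sigma> u, \<sigma> v}"
        if "u \<noteq> v" "d \<noteq> u" "d \<noteq> v" for u v
      proof -
        have "((t, {u, v}), (t', \<sigma> ` {u, v})) \<in> edge_gluing G"
          unfolding edge_gluing_def using G that by fastforce
        then show ?thesis using inv by fastforce
      qed
      then have "2 * arc_sum n t a d = 2 * arc_sum n t' (\<sigma> a) (\<sigma> d)"
        using abcd unfolding arc_sum_eq_edge_weights[OF abcd] arc_sum_eq_edge_weights[OF abcd'] by auto
      then show ?thesis by simp
    qed
    then show "n \<in> solution_space G" unfolding sol by blast
  qed
qed

section \<open>Weights of the tetrahedral and edge surfaces\<close>

lemma edge_gluing_card:
  assumes "face_pairing G" "((t, x), (t', x')) \<in> edge_gluing G"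
  shows "card x = 2" "card x' = 2"
proof -
  obtain d \<sigma> where *: "card x = 2" "G (t, d) = (t', \<sigma>)" "x' = \<sigma> ` x"
    using assms(2) unfolding edge_gluing_def by auto
  have "inj \<sigma>"
    using assms(1) *(2) unfolding face_pairing_def by (blast dest: bij_is_inj)
  then show "card x = 2" "card x' = 2"
    using *(1) by (simp_all add: *(3) card_image inj_on_subset)
qed

lemma linear_edge_weight: "linear (\<lambda>n. edge_weight n t x)"
  by (rule linearI) (simp_all add: edge_weight_def sum.distrib sum_distrib_left)

text \<open>At each arc the triangle and the quadrilateral of a tetrahedral surface cancel.\<close>

lemma edge_weight_tetrahedral_surface:
  assumes "card x = 2"
  shows "edge_weight (tetrahedral_surface i) t x = 0"
proof -
  have arc: "arc_sum (tetrahedral_surface i) t a d = 0" if ad: "a \<noteq> d" for a d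
  proof -
    obtain q where "{a, d} \<in> separated_edges q" using ex_separating_quad[OF ad] .
    then show ?thesis using ad by (simp add: arc_sum_eq tetrahedral_surface_def)
  qed
  obtain a b where x: "x = {a, b}" "a \<noteq> b" using assms by (auto simp: card_2_iff)
  obtain c d where "distinct [a, c, d, b]" using ex_other_vertices[OF x(2)] .
  then have "distinct [a, b, d]" "a \<noteq> d" "b \<noteq> d" by auto
  then show ?thesis using arc by (simp add: x edge_weight_eq_arc_sums[of a b d])
qed

text \<open>The arc cutting off \<open>a\<close> lies on the triangle at \<open>a\<close>, which carries minus the number of edges
  at \<open>a\<close> that are in \<open>E\<close>, and on the quadrilateral that separates \<open>ad\<close> from \<open>bc\<close>. The
  contributions of \<open>ad\<close> cancel, so the arc number is determined by the edges of the face
  \<open>abc\<close>, and adding the arc numbers at \<open>a\<close> and \<open>b\<close> cancels all edges except \<open>ab\<close>.\<close>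

lemma edge_weight_edge_surface:
  assumes "card x = 2"
  shows "edge_weight (edge_surface E) t x = - 2 * of_bool ((t, x) \<in> E)"
proof -
  define m where "m u v = (of_bool ((t, {u, v}) \<in> E) :: real)" for u v
  have card_eq: "real (card {x \<in> X. (t, x) \<in> E}) = (\<Sum>x\<in>X. of_bool ((t, x) \<in> E))" for X
    by (simp add: sum.If_cases of_bool_def Int_def)
  have arc: "arc_sum (edge_surface E) t a d = m b c - m a b - m a c"
    if abcd: "distinct [a, b, c, d]" for a b c d
  proof -
    obtain q where q: "{a, d} \<in> separated_edges q"
      using abcd ex_separating_quad by (metis distinct_length_2_or_more)
    note UN = UNIV_vert_eq[OF abcd]
    have "- {a, d} = {b, c}" using abcd UN by auto
    then have sep: "separated_edges q = {{a, d}, {b, c}}"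
      using separated_edges_complement[OF q] by simp
    have "corners (Tri a) = {{a, b}, {a, c}, {a, d}}"
    proof -
      have "x \<in> {{a, b}, {a, c}, {a, d}}" if "card x = 2" "a \<in> x" for x
      proof -
        obtain v where "x = {a, v}" "v \<noteq> a" using \<open>card x = 2\<close> \<open>a \<in> x\<close> by (auto simp: card_2_iff)
        moreover have "v \<in> {a, b, c, d}" using UN by blast
        ultimately show ?thesis by auto
      qed
      then show ?thesis using abcd by auto
    qed
    moreover have "edge_surface E $ (t, Tri a) = - (\<Sum>x\<in>corners (Tri a). of_bool ((t, x) \<in> E))"
      by (simp add: edge_surface_def card_eq del: corners.simps)
    ultimately have tri: "edge_surface E $ (t, Tri a) = - (m a b + m a c + m a d)"
      using abcd by (simp add: m_def doubleton_eq_iff del: corners.simps)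
    have "edge_surface E $ (t, Quad q) = (\<Sum>x\<in>separated_edges q. of_bool ((t, x) \<in> E))"
      by (simp add: edge_surface_def card_eq)
    then have quad: "edge_surface E $ (t, Quad q) = m a d + m b c"
      using abcd by (simp add: m_def sep doubleton_eq_iff)
    show ?thesis using abcd q by (simp add: arc_sum_eq tri quad)
  qed
  obtain a b where x: "x = {a, b}" "a \<noteq> b" using assms by (auto simp: card_2_iff)
  obtain c d where "distinct [a, c, d, b]" using ex_other_vertices[OF x(2)] .
  then have "distinct [a, b, c, d]" "distinct [b, a, c, d]" "distinct [a, b, d]" by auto
  then have "edge_weight (edge_surface E) t x = (m b c - m a b - m a c) + (m a c - m b a - m b c)"
    by (simp only: x edge_weight_eq_arc_sums[of a b d] arc[of a b c d] arc[of b a c d])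
  also have "\<dots> = - 2 * of_bool ((t, x) \<in> E)"
    by (simp add: m_def x insert_commute)
  finally show ?thesis .
qed

text \<open>When all edge weights vanish, so do all arc numbers, so that each triangle coordinate is the
  negative of each quadrilateral coordinate of the same tetrahedron. The vector is
  therefore determined by one quadrilateral coordinate in each tetrahedron.\<close>

lemma edge_weight_zero_imp_tetrahedral:
  fixes n :: "real ^ ('t::finite \<times> disk)"
  assumes zero: "\<And>t x. card x = 2 \<Longrightarrow> edge_weight n t x = 0"
  shows "n = (\<Sum>i\<in>UNIV. n $ (i, Quad AB_CD) *\<^sub>R tetrahedral_surface i)"
proof -
  have arc: "n $ (t, Tri a) = - n $ (t, Quad q)"
    if "a \<noteq> d" "{a, d} \<in> separated_edges q" for t a d q
  proof -
    obtain b c where abcd: "distinct [a, b, c, d]" using ex_other_vertices[OF \<open>a \<noteq> d\<close>] .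
    then have "2 * arc_sum n t a d = 0"
      unfolding arc_sum_eq_edge_weights[OF abcd] by (simp add: zero)
    then show ?thesis using arc_sum_eq[OF that, of n t] by simp
  qed
  have tri: "n $ (t, Tri a) = - n $ (t, Quad AB_CD)" for t a
    using arc[of A B AB_CD] arc[of B A AB_CD] arc[of C D AB_CD] arc[of D C AB_CD]
    by (cases a) (auto simp: insert_commute)
  have quad: "n $ (t, Quad q) = n $ (t, Quad AB_CD)" for t q
    using arc[of A B AB_CD t] arc[of A C AC_BD t] arc[of A D AD_BC t] by (cases q) auto
  show ?thesis
  proof (subst vec_eq_iff, rule allI)
    fix p :: "'t \<times> disk"
    obtain t \<delta> where p: "p = (t, \<delta>)" by fastforce
    have "(\<Sum>i\<in>UNIV. n $ (i, Quad AB_CD) *\<^sub>R tetrahedral_surface i) $ p =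
        (\<Sum>i\<in>UNIV. if i = t then n $ (i, Quad AB_CD) * (case \<delta> of Tri _ \<Rightarrow> -1 | Quad _ \<Rightarrow> 1) else 0)"
      unfolding sum_component by (rule sum.cong) (auto simp: tetrahedral_surface_def p)
    also have "\<dots> = n $ p"
    proof (cases \<delta>)
      case (Tri a)
      then show ?thesis using tri[of t a] by (simp add: p)
    next
      case (Quad q)
      then show ?thesis using quad[of t q] by (simp add: p)
    qed
    finally show "n $ p = (\<Sum>i\<in>UNIV. n $ (i, Quad AB_CD) *\<^sub>R tetrahedral_surface i) $ p" ..
  qed
qed

section \<open>The basis\<close>

text \<open>Independence of an indexed family, rather than of its set of values, includes injectivity:
  a repeated vector would give a nontrivial relation.\<close>

lemma inj_on_independent_if_scalars_zero:
  fixes f :: "'i \<Rightarrow> 'v::real_vector"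
  assumes "finite I" and zero: "\<And>c i. (\<Sum>i\<in>I. c i *\<^sub>R f i) = 0 \<Longrightarrow> i \<in> I \<Longrightarrow> c i = 0"
  shows "inj_on f I" and "independent (f ` I)"
proof -
  show inj: "inj_on f I"
  proof (rule inj_onI, rule ccontr)
    fix i j assume ij: "i \<in> I" "j \<in> I" "f i = f j" "i \<noteq> j"
    define c where "c l = (if l = i then 1 else 0) - (if l = j then 1 else 0 :: real)" for l
    have "(\<Sum>l\<in>I. c l *\<^sub>R f l) =
        (\<Sum>l\<in>I. if l = i then f l else 0) - (\<Sum>l\<in>I. if l = j then f l else 0)"
      unfolding sum_subtractf[symmetric] by (rule sum.cong) (auto simp: c_def)
    then have "(\<Sum>l\<in>I. c l *\<^sub>R f l) = 0" using ij \<open>finite I\<close> by simp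
    then have "c i = 0" using zero ij(1) by blast
    then show False using ij(4) by (simp add: c_def)
  qed
  show "independent (f ` I)"
  proof (rule independent_if_scalars_zero)
    fix g v assume "(\<Sum>x\<in>f ` I. g x *\<^sub>R x) = 0" "v \<in> f ` I"
    then show "g v = 0"
      using zero[of "\<lambda>i. g (f i)"] by (auto simp: sum.reindex[OF inj])
  qed (use \<open>finite I\<close> in simp)
qed

lemma subspace_solution_space: "subspace (solution_space G)"
  by (auto simp: subspace_def solution_space_def sum.distrib simp flip: sum_distrib_left)

text \<open>The weight map takes a relation between the proposed basis vectors to a relation between the
  indicators of disjoint edge classes, which leaves only tetrahedral surfaces. For
  spanning, subtract from a solution the edge surfaces that match its weights; what remains
  is in the kernel of the weight map.\<close>

lemma solution_space_basis:
  fixes G :: "'t::finite gluing"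
  assumes "face_pairing G"
  defines "f \<equiv> case_sum tetrahedral_surface edge_surface"
  shows "inj_on f (UNIV <+> edges G)" and "independent (f ` (UNIV <+> edges G))"
    and "span (f ` (UNIV <+> edges G)) = solution_space G"
proof -
  define r where "r = (edge_gluing G \<union> (edge_gluing G)\<inverse>)\<^sup>*"
  have edges: "edges G = {(t, x). card x = 2} // r"
    by (simp add: edges_def r_def)
  have "sym r" unfolding r_def by (intro sym_rtrancl sym_Un_converse)
  then have equiv: "equiv UNIV r"
    by (intro equivI) (auto simp: r_def refl_on_def trans_rtrancl)
  have fin: "finite (edges G)"
    by simp
  have edge_iff: "p \<in> E \<longleftrightarrow> E = r `` {p}" if E: "E \<in> edges G" for p E
  proof -
    obtain q where "E = r `` {q}" using E unfolding edges by (auto elim: quotientE)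
    then show ?thesis using equiv_class_eq_iff[OF equiv, of q p] by auto
  qed
  have sum_class: "(\<Sum>E\<in>edges G. c E * of_bool ((t, x) \<in> E)) = (c (r `` {(t, x)}) :: real)"
    if "card x = 2" for c t x
  proof -
    have "r `` {(t, x)} \<in> edges G" unfolding edges using that by (auto intro: quotientI)
    moreover have "(\<Sum>E\<in>edges G. c E * of_bool ((t, x) \<in> E)) =
        (\<Sum>E\<in>edges G. if E = r `` {(t, x)} then c E else 0)"
      by (rule sum.cong) (auto simp: edge_iff)
    ultimately show ?thesis using fin by simp
  qed
  have weight_sum: "edge_weight (\<Sum>E\<in>edges G. c E *\<^sub>R edge_surface E) t x = - 2 * c (r `` {(t, x)})"
    if "card x = 2" for c t x
  proof -
    have "edge_weight (\<Sum>E\<in>edges G. c E *\<^sub>R edge_surface E) t x =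
        (\<Sum>E\<in>edges G. (- 2 * c E) * of_bool ((t, x) \<in> E))"
      unfolding linear_sum[OF linear_edge_weight]
      by (rule sum.cong)
        (simp_all add: linear_scale[OF linear_edge_weight] edge_weight_edge_surface that)
    then show ?thesis by (simp only: sum_class[OF that])
  qed
  have weight_sum_tet: "edge_weight (\<Sum>i\<in>UNIV. c i *\<^sub>R tetrahedral_surface i) t x = 0"
    if "card x = 2" for c t x
    using that by (simp add: linear_sum[OF linear_edge_weight] linear_scale[OF linear_edge_weight]
          edge_weight_tetrahedral_surface)
  have zero: "c j = 0" if c: "(\<Sum>j\<in>UNIV <+> edges G. c j *\<^sub>R f j) = 0" and j: "j \<in> UNIV <+> edges G"
    for c j
  proof -
    have split: "(\<Sum>i\<in>UNIV. c (Inl i) *\<^sub>R tetrahedral_surface i)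
        + (\<Sum>E\<in>edges G. c (Inr E) *\<^sub>R edge_surface E) = 0"
      using c fin by (simp add: sum.Plus f_def)
    have edge: "c (Inr E) = 0" if EG: "E \<in> edges G" for E
    proof -
      obtain t x where E: "E = r `` {(t, x)}" "card x = 2"
        using EG unfolding edges by (auto elim!: quotientE)
      show ?thesis
        \<comment> \<open>Compare the weights of both sides of the relation on an edge in the class \<open>E\<close>.\<close>
        using arg_cong[OF split, of "\<lambda>n. edge_weight n t x"] weight_sum[OF E(2), of "\<lambda>E. c (Inr E)" t]
          weight_sum_tet[OF E(2), of "\<lambda>i. c (Inl i)" t]
        by (simp add: linear_add[OF linear_edge_weight] linear_0[OF linear_edge_weight] E(1))
    qed
    \<comment> \<open>The coordinate of any quadrilateral of \<open>t\<close> isolates the tetrahedral surface of \<open>t\<close>.\<close>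
    have tet: "c (Inl t) = 0" for t
    proof -
      have "(\<Sum>i\<in>UNIV. c (Inl i) *\<^sub>R tetrahedral_surface i) $ (t, Quad AB_CD) = 0"
        using split edge by simp
      moreover have "(\<Sum>i\<in>UNIV. c (Inl i) *\<^sub>R tetrahedral_surface i) $ (t, Quad AB_CD)
          = (\<Sum>i\<in>UNIV. if i = t then c (Inl i) else 0)"
        unfolding sum_component by (rule sum.cong) (auto simp: tetrahedral_surface_def)
      ultimately show ?thesis by simp
    qed
    show ?thesis using j edge tet by auto
  qed
  have "finite (UNIV <+> edges G :: ('t + _) set)" using fin by simp
  then show "inj_on f (UNIV <+> edges G)" "independent (f ` (UNIV <+> edges G))"
    using zero by (rule inj_on_independent_if_scalars_zero; blast)+
  show "span (f ` (UNIV <+> edges G)) = solution_space G"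
  proof
    have "tetrahedral_surface i \<in> solution_space G" for i
      using edge_gluing_card[OF assms(1)]
      by (simp add: solution_iff_edge_weight_invariant[OF assms(1)] edge_weight_tetrahedral_surface)
    moreover have "edge_surface E \<in> solution_space G" if E: "E \<in> edges G" for E
    proof -
      have "(t, x) \<in> E \<longleftrightarrow> (t', x') \<in> E" if "((t, x), (t', x')) \<in> edge_gluing G" for t x t' x'
        using edge_iff[OF E] equiv_class_eq[OF equiv, of "(t, x)" "(t', x')"] that
        by (auto simp: r_def)
      then show ?thesis
        using edge_gluing_card[OF assms(1)]
        by (simp add: solution_iff_edge_weight_invariant[OF assms(1)] edge_weight_edge_surface)
    qed
    ultimately have "f ` (UNIV <+> edges G) \<subseteq> solution_space G"
      unfolding f_def by (intro image_subsetI) (elim PlusE; simp)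
    then show "span (f ` (UNIV <+> edges G)) \<subseteq> solution_space G"
      by (rule span_minimal[OF _ subspace_solution_space])
    show "solution_space G \<subseteq> span (f ` (UNIV <+> edges G))"
    proof
      fix n assume n: "n \<in> solution_space G"
      define w where "w = (\<lambda>(t, x). edge_weight n t x)"
      have "w (t, x) = w (t', x')" if "((t, x), (t', x')) \<in> edge_gluing G" for t x t' x'
        using n that unfolding solution_iff_edge_weight_invariant[OF assms(1)] w_def prod.case
        by blast
      then have w_gluing: "w p = w q" if "(p, q) \<in> edge_gluing G" for p q
        using that by (metis surj_pair)
      have w: "w p = w q" if "(p, q) \<in> r" for p q
        using that unfolding r_def
      proof (induction rule: rtrancl_induct)
        case (step p' q')
        then show ?case using w_gluing by (metis Un_iff converse_iff)
      qed simp
      \<comment> \<open>The weight of \<open>n\<close> is constant on \<open>E\<close>; an edge surface has weight \<open>-2\<close> on its own edge.\<close>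
      define c where "c E = - w (SOME p. p \<in> E) / 2" for E
      have c: "- 2 * c (r `` {p}) = w p" for p
      proof -
        have "p \<in> r `` {p}" by (simp add: r_def)
        then have "(SOME q. q \<in> r `` {p}) \<in> r `` {p}" by (rule someI)
        then have "(p, SOME q. q \<in> r `` {p}) \<in> r" by blast
        then show ?thesis using w by (fastforce simp: c_def)
      qed
      let ?b = "\<Sum>E\<in>edges G. c E *\<^sub>R edge_surface E"
      let ?a = "\<Sum>i\<in>UNIV. (n - ?b) $ (i, Quad AB_CD) *\<^sub>R tetrahedral_surface i"
      have "n - ?b = ?a"
      proof (rule edge_weight_zero_imp_tetrahedral)
        fix t and x :: "vert set" assume "card x = 2"
        then show "edge_weight (n - ?b) t x = 0"
          using c[of "(t, x)"]
          by (simp add: linear_diff[OF linear_edge_weight] weight_sum w_def)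
      qed
      then have n_eq: "n = ?a + ?b" by (simp add: algebra_simps)
      have "?a \<in> span (f ` (UNIV <+> edges G))"
        by (intro span_sum span_scale span_base) (force simp: f_def)
      moreover have "?b \<in> span (f ` (UNIV <+> edges G))"
        by (intro span_sum span_scale span_base) (force simp: f_def)
      ultimately have "?a + ?b \<in> span (f ` (UNIV <+> edges G))"
        by (rule span_add)
      with n_eq show "n \<in> span (f ` (UNIV <+> edges G))"
        by (rule ssubst)
    qed
  qed
qed

theorem theorem2p1:
  fixes M :: "'a topology" and N :: "'b topology" and \<Gamma> :: "'t::finite gluing"
  assumes "manifold3 M" and "irreducible_manifold3 M" and "P2_irreducible_manifold3 M"
    and "(manifold3_with_boundary N \<and> compact_space N \<and>
          (\<forall>S \<in> connected_components_of (subtopology N (manifold3_boundary N)).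
             subtopology N S homeomorphic_space torus \<or>
             subtopology N S homeomorphic_space klein_bottle) \<and>
          M homeomorphic_space subtopology N (manifold3_interior N) \<and>
          ideal_pseudo_triangulation \<Gamma> M)
         \<or> (compact_space M \<and> pseudo_triangulation \<Gamma> M)"
  shows "inj_on (case_sum tetrahedral_surface edge_surface) (UNIV <+> edges \<Gamma>) \<and>
         independent (case_sum tetrahedral_surface edge_surface ` (UNIV <+> edges \<Gamma>)) \<and>
         span (case_sum tetrahedral_surface edge_surface ` (UNIV <+> edges \<Gamma>)) = solution_space \<Gamma>"
proof -
  have "face_pairing \<Gamma>"
    using assms(4) by (auto simp: pseudo_triangulation_def ideal_pseudo_triangulation_def)
  then show ?thesis
    by (intro conjI solution_space_basis)
qed

end
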